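(* Let $\mathcal P$ be a prediction set with respect to a measure space $(\Omega,\mathcal A,\mu)$ and let $\Phi:\mathcal P^+\to\mathbb R$ be a sublinear function. Let $q\in\mathcal P^+$. Then $\Phi$ has a $\mathcal P$-integrable subgradient at $q$ if and only if there is $q^*\in\mathcal L(\mathcal P)$ such that $$p\cdot q^*\le \Phi_+'(p,q)$$ for all $p\in\mathcal P^+$, with equality for $p=q$.
   Context: A prediction set $\mathcal P$ is a convex set of probability densities on $\Omega$ with respect to $\mu$, where $(\Omega,\mathcal A,\mu)$ is a measure space. The prediction cone is $\mathcal P^+=\{\lambda p \mid \lambda>0,\ p\in\mathcal P\}$, and $\operatorname{span}\mathcal P$ is the linear span of $\mathcal P$. $\mathcal L(\mathcal P)$ is the set of all $\mu$-measurable functions $f:\Omega\to\mathbb R$ with $\int_\Omega |f(x)|p(x)\,d\mu(x)<\infty$ for all $p\in\mathcal P$. For $p\in\operatorname{span}\mathcal P$ and $f\in\mathcal L(\mathcal P)$, $p\cdot f=\int_\Omega f(x)p(x)\,d\mu(x)$. A function $\Phi:\mathcal P^+\to\mathbb R$ is sublinear if $\Phi(\lambda p)=\lambda\Phi(p)$ and $\Phi(p+r)\le\Phi(p)+\Phi(r)$ for all $p,r\in\mathcal P^+$, $\lambda>0$. A $\mathcal P$-integrable subgradient of $\Phi$ at $q\in\mathcal P^+$ is an element $q^*\in\mathcal L(\mathcal P)$ such that $\Phi(p)\ge p\cdot q^*$ for all $p\in\mathcal P^+$, with equality for $p=q$. For $q\in\mathcal P^+$ let $\mathcal D(q)=\{p\in\operatorname{span}\mathcal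 P\mid \exists\,\epsilon>0:\ q+\epsilon p\in\mathcal P^+\}$ (by convexity then $q+tp\in\mathcal P^+$ for all $t\in[0,\epsilon]$); it contains $\mathcal P^+$. For $p\in\mathcal D(q)$ the right directional derivative is $$\Phi_+'(p,q)=\lim_{t\to0^+}\frac{\Phi(q+tp)-\Phi(q)}{t},$$ which for sublinear $\Phi$ exists in $\mathbb R\cup\{-\infty\}$. *)

theory Defs
  imports "HOL-Analysis.Analysis"
begin

text \<open>Densities are real functions, not classes modulo null sets; functions that agree almost
  everywhere may be distinct elements of a prediction set.\<close>

definition probability_density :: "'a measure \<Rightarrow> ('a \<Rightarrow> real) \<Rightarrow> bool" where
  "probability_density M p \<longleftrightarrow>
     p \<in> borel_measurable M \<and> (\<forall>x\<in>space M. 0 \<le> p x) \<and> (\<integral>\<^sup>+ x. ennreal (p x) \<partial>M) = 1"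

text \<open>Convexity is written out pointwise because the function type is not an instance of
  \<^class>\<open>real_vector\<close>, which \<^const>\<open>convex\<close> requires.\<close>

definition prediction_set :: "'a measure \<Rightarrow> ('a \<Rightarrow> real) set \<Rightarrow> bool" where
  "prediction_set M P \<longleftrightarrow>
     (\<forall>p\<in>P. probability_density M p) \<and>
     (\<forall>p\<in>P. \<forall>r\<in>P. \<forall>u\<ge>0. \<forall>v\<ge>0. u + v = 1 \<longrightarrow> (\<lambda>x. u * p x + v * r x) \<in> P)"

definition prediction_cone :: "('a \<Rightarrow> real) set \<Rightarrow> ('a \<Rightarrow> real) set" where
  "prediction_cone P = {(\<lambda>x. c * p x) | c p. c > 0 \<and> p \<in> P}"

definition integrable_class :: "'a measure \<Rightarrow> ('a \<Rightarrow> real) set \<Rightarrow> ('a \<Rightarrow> real) set" where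
  "integrable_class M P =
     {f \<in> borel_measurable M. \<forall>p\<in>P. (\<integral>\<^sup>+ x. ennreal (\<bar>f x\<bar> * p x) \<partial>M) < \<infinity>}"

definition pairing :: "'a measure \<Rightarrow> ('a \<Rightarrow> real) \<Rightarrow> ('a \<Rightarrow> real) \<Rightarrow> real" where
  "pairing M p f = (\<integral>x. f x * p x \<partial>M)"

text \<open>A function on the prediction cone is a total function whose values off the cone are
  never used.\<close>

definition sublinear_on_cone :: "('a \<Rightarrow> real) set \<Rightarrow> (('a \<Rightarrow> real) \<Rightarrow> real) \<Rightarrow> bool" where
  "sublinear_on_cone P \<Phi> \<longleftrightarrow>
     (\<forall>p\<in>prediction_cone P. \<forall>c>0. \<Phi> (\<lambda>x. c * p x) = c * \<Phi> p) \<and>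
     (\<forall>p\<in>prediction_cone P. \<forall>r\<in>prediction_cone P. \<Phi> (\<lambda>x. p x + r x) \<le> \<Phi> p + \<Phi> r)"

definition integrable_subgradient ::
  "'a measure \<Rightarrow> ('a \<Rightarrow> real) set \<Rightarrow> (('a \<Rightarrow> real) \<Rightarrow> real) \<Rightarrow> ('a \<Rightarrow> real) \<Rightarrow> ('a \<Rightarrow> real) \<Rightarrow> bool" where
  "integrable_subgradient M P \<Phi> q qs \<longleftrightarrow>
     qs \<in> integrable_class M P \<and>
     (\<forall>p\<in>prediction_cone P. pairing M p qs \<le> \<Phi> p) \<and>
     pairing M q qs = \<Phi> q"

text \<open>The limit is taken in the extended reals, where it may be \<open>-\<infinity>\<close>. It is used only for
  directions \<open>p\<close> in the prediction cone, which are admissible at every \<open>q\<close> in the cone;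
  the lemma at the end shows that the limit exists there.\<close>

definition right_directional_derivative ::
  "(('a \<Rightarrow> real) \<Rightarrow> real) \<Rightarrow> ('a \<Rightarrow> real) \<Rightarrow> ('a \<Rightarrow> real) \<Rightarrow> ereal" where
  "right_directional_derivative \<Phi> p q =
     Lim (at_right 0) (\<lambda>t::real. ereal ((\<Phi> (\<lambda>x. q x + t * p x) - \<Phi> q) / t))"

lemma prediction_cone_scale:
  assumes "p \<in> prediction_cone P" "c > 0"
  shows "(\<lambda>x. c * p x) \<in> prediction_cone P"
proof -
  obtain d r where "d > 0" "r \<in> P" "p = (\<lambda>x. d * r x)"
    using assms(1) unfolding prediction_cone_def by blast
  then have "(\<lambda>x. c * p x) = (\<lambda>x. (c * d) * r x)" "c * d > 0"
    using assms(2) by (auto simp: mult.assoc)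
  then show ?thesis
    unfolding prediction_cone_def using \<open>r \<in> P\<close> by blast
qed

lemma prediction_cone_add:
  assumes "prediction_set M P" "p \<in> prediction_cone P" "r \<in> prediction_cone P"
  shows "(\<lambda>x. p x + r x) \<in> prediction_cone P"
proof -
  obtain a p' where a: "a > 0" "p' \<in> P" "p = (\<lambda>x. a * p' x)"
    using assms(2) unfolding prediction_cone_def by blast
  obtain b r' where b: "b > 0" "r' \<in> P" "r = (\<lambda>x. b * r' x)"
    using assms(3) unfolding prediction_cone_def by blast
  let ?s = "\<lambda>x. a / (a + b) * p' x + b / (a + b) * r' x"
  have "a / (a + b) + b / (a + b) = 1"
    using a b by (simp flip: add_divide_distrib)
  then have s: "?s \<in> P"
    using assms(1) a b unfolding prediction_set_def
    by (metis add_nonneg_nonneg divide_nonneg_nonneg less_imp_le)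
  have "(\<lambda>x. p x + r x) = (\<lambda>x. (a + b) * ?s x)"
    using a b by (simp add: distrib_left)
  moreover have "a + b > 0" using a b by simp
  ultimately show ?thesis
    unfolding prediction_cone_def using s
    by (intro CollectI exI[of _ "a + b"] exI[of _ ?s] conjI)
qed

lemma right_directional_derivative_tendsto:
  assumes P: "prediction_set M P" and sub: "sublinear_on_cone P \<Phi>"
    and q: "q \<in> prediction_cone P" and p: "p \<in> prediction_cone P"
  shows "((\<lambda>t. ereal ((\<Phi> (\<lambda>x. q x + t * p x) - \<Phi> q) / t))
            \<longlongrightarrow> right_directional_derivative \<Phi> p q) (at_right 0)"
proof -
  have hom: "\<Phi> (\<lambda>x. c * r x) = c * \<Phi> r" if "r \<in> prediction_cone P" "c > 0" for r c
    using sub that unfolding sublinear_on_cone_def by simp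
  let ?g = "\<lambda>t. (\<Phi> (\<lambda>x. q x + t * p x) - \<Phi> q) / t"
  have mono: "?g s \<le> ?g t" if st: "0 < s" "s < t" for s t
  proof -
    define w where "w = s / t"
    have w: "0 < w" "w < 1" "s = w * t" using st by (auto simp: w_def)
    have qt: "(\<lambda>x. q x + t * p x) \<in> prediction_cone P"
      using prediction_cone_add[OF P q prediction_cone_scale[OF p]] st by simp
    have eq: "(\<lambda>x. q x + s * p x) = (\<lambda>x. (1 - w) * q x + w * (q x + t * p x))"
      by (auto simp: w(3) algebra_simps)
    have "\<Phi> (\<lambda>x. q x + s * p x)
        \<le> \<Phi> (\<lambda>x. (1 - w) * q x) + \<Phi> (\<lambda>x. w * (q x + t * p x))"
      unfolding eq using sub prediction_cone_scale[OF q, of "1 - w"]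
        prediction_cone_scale[OF qt, of w] w
      unfolding sublinear_on_cone_def by simp
    also have "\<dots> = (1 - w) * \<Phi> q + w * \<Phi> (\<lambda>x. q x + t * p x)"
      using hom[OF q, of "1 - w"] hom[OF qt, of w] w by simp
    finally have "\<Phi> (\<lambda>x. q x + s * p x) - \<Phi> q \<le> w * (\<Phi> (\<lambda>x. q x + t * p x) - \<Phi> q)"
      by (simp add: algebra_simps)
    then have "?g s \<le> w * (\<Phi> (\<lambda>x. q x + t * p x) - \<Phi> q) / s"
      using st by (intro divide_right_mono) auto
    also have "\<dots> = ?g t" using w st by simp
    finally show ?thesis .
  qed
  define L where "L = (INF t\<in>{0<..}. ereal (?g t))"
  have lim: "((\<lambda>t. ereal (?g t)) \<longlongrightarrow> L) (at_right 0)"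
  proof (rule order_tendstoI)
    fix a assume "a < L"
    moreover have "L \<le> ereal (?g t)" if "0 < t" for t
      unfolding L_def using that by (intro INF_lower) auto
    ultimately show "\<forall>\<^sub>F t in at_right 0. a < ereal (?g t)"
      by (auto simp: eventually_at_right_less eventually_at_filter intro!: always_eventually
          intro: less_le_trans)
  next
    fix a assume "L < a"
    then obtain t where t: "0 < t" "ereal (?g t) < a"
      unfolding L_def INF_less_iff by auto
    have "ereal (?g s) < a" if "0 < s" "s < t" for s
      using mono[OF that] t(2) by (meson ereal_less_eq(3) le_less_trans)
    then show "\<forall>\<^sub>F s in at_right 0. ereal (?g s) < a"
      unfolding eventually_at_right_field using t(1) by blast
  qed
  then have "right_directional_derivative \<Phi> p q = L"
    unfolding right_directional_derivative_def by (intro tendsto_Lim) auto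
  with lim show ?thesis by simp
qed

end

theory Submission
  imports Defs
begin

text \<open>For \<open>t > 0\<close>, sublinearity gives \<open>\<Phi> (q + t p) \<le> \<Phi> q + t \<Phi> p\<close>, so the right
  derivative in direction \<open>p\<close> is at most \<open>\<Phi> p\<close>, and homogeneity gives
  \<open>\<Phi> (q + t q) = (1 + t) \<Phi> q\<close>, so in direction \<open>q\<close> it equals \<open>\<Phi> q\<close>. Hence any linear
  functional bounded by the derivative is bounded by \<open>\<Phi>\<close>. Conversely, a linear functional
  below \<open>\<Phi>\<close> and equal to it at \<open>q\<close> is below every difference quotient at \<open>q\<close>.\<close>

text \<open>Densities are nonnegative on \<open>space M\<close>, so the finite integral in
  \<open>integrable_class\<close> is that of the norm of the product, and a positive factor carries
  integrability from \<open>P\<close> to the cone. This makes the Bochner integral in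
  \<open>pairing\<close> genuine rather than the default 0.\<close>

lemma integrable_class_integrable:
  assumes "prediction_set M P" "p \<in> prediction_cone P" "f \<in> integrable_class M P"
  shows "integrable M (\<lambda>x. f x * p x)"
proof -
  obtain c r where c: "r \<in> P" "p = (\<lambda>x. c * r x)"
    using assms(2) unfolding prediction_cone_def by blast
  have r: "r \<in> borel_measurable M" "\<And>x. x \<in> space M \<Longrightarrow> 0 \<le> r x"
    using assms(1) c(1) unfolding prediction_set_def probability_density_def by auto
  have f: "f \<in> borel_measurable M" "(\<integral>\<^sup>+ x. ennreal (\<bar>f x\<bar> * r x) \<partial>M) < \<infinity>"
    using assms(3) c(1) unfolding integrable_class_def by auto
  have "(\<integral>\<^sup>+ x. ennreal (norm (f x * r x)) \<partial>M) = (\<integral>\<^sup>+ x. ennreal (\<bar>f x\<bar> * r x) \<partial>M)"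
    by (rule nn_integral_cong) (simp add: abs_mult r)
  then have "integrable M (\<lambda>x. f x * r x)"
    using f r(1) by (intro integrableI_bounded) simp_all
  then show ?thesis
    unfolding c(2) mult.left_commute[of "f _"] by (rule integrable_mult_right)
qed

text \<open>Splitting the integral is legitimate because both summands are integrable. It makes the
  difference quotients of \<open>pairing\<close> at \<open>q\<close> independent of
  \<open>t\<close>.\<close>

lemma pairing_add_scaled:
  assumes "prediction_set M P" "f \<in> integrable_class M P"
    and "q \<in> prediction_cone P" "p \<in> prediction_cone P"
  shows "pairing M (\<lambda>x. q x + t * p x) f = pairing M q f + t * pairing M p f"
  using integrable_class_integrable[OF assms(1,3,2)] integrable_class_integrable[OF assms(1,4,2)]
  by (simp add: pairing_def distrib_left mult.left_commute[of "f _"])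

lemma right_directional_derivative_le:
  assumes P: "prediction_set M P" and sub: "sublinear_on_cone P \<Phi>"
    and q: "q \<in> prediction_cone P" and p: "p \<in> prediction_cone P"
  shows "right_directional_derivative \<Phi> p q \<le> ereal (\<Phi> p)"
\<comment> \<open>The limit exists in the extended reals, so a bound valid for every
  \<open>t > 0\<close> passes to it, even if it is -infinity.\<close>
proof (rule tendsto_upperbound[OF right_directional_derivative_tendsto[OF assms]])
  have "(\<Phi> (\<lambda>x. q x + t * p x) - \<Phi> q) / t \<le> \<Phi> p" if "0 < t" for t
  proof -
    have "\<Phi> (\<lambda>x. q x + t * p x) \<le> \<Phi> q + \<Phi> (\<lambda>x. t * p x)"
      using sub q prediction_cone_scale[OF p that] unfolding sublinear_on_cone_def by simp
    also have "\<Phi> (\<lambda>x. t * p x) = t * \<Phi> p"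
      using sub p that unfolding sublinear_on_cone_def by simp
    finally show ?thesis
      using that by (simp add: divide_le_eq mult.commute)
  qed
  then show "\<forall>\<^sub>F t in at_right 0. ereal ((\<Phi> (\<lambda>x. q x + t * p x) - \<Phi> q) / t) \<le> ereal (\<Phi> p)"
    by (auto simp: eventually_at_filter)
qed simp

lemma right_directional_derivative_self:
  assumes "sublinear_on_cone P \<Phi>" "q \<in> prediction_cone P"
  shows "right_directional_derivative \<Phi> q q = ereal (\<Phi> q)"
proof -
  have "(\<Phi> (\<lambda>x. q x + t * q x) - \<Phi> q) / t = \<Phi> q" if "0 < t" for t
  proof -
    \<comment> \<open>Moving from \<open>q\<close> in direction \<open>q\<close> stays on its ray,
      where homogeneity makes the quotient constant.\<close>
    have "\<Phi> (\<lambda>x. (1 + t) * q x) = (1 + t) * \<Phi> q"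
      using assms that unfolding sublinear_on_cone_def by simp
    then show ?thesis
      using that by (simp add: distrib_right)
  qed
  then have "\<forall>\<^sub>F t in at_right 0. ereal ((\<Phi> (\<lambda>x. q x + t * q x) - \<Phi> q) / t) = ereal (\<Phi> q)"
    by (auto simp: eventually_at_filter)
  then show ?thesis
    unfolding right_directional_derivative_def
    by (intro tendsto_Lim tendsto_eventually) simp_all
qed

lemma integrable_subgradient_le_right_directional_derivative:
  assumes P: "prediction_set M P" and sub: "sublinear_on_cone P \<Phi>"
    and q: "q \<in> prediction_cone P" and p: "p \<in> prediction_cone P"
    and qs: "integrable_subgradient M P \<Phi> q qs"
  shows "ereal (pairing M p qs) \<le> right_directional_derivative \<Phi> p q"
proof (rule tendsto_lowerbound[OF right_directional_derivative_tendsto[OF P sub q p]])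
  have "pairing M p qs \<le> (\<Phi> (\<lambda>x. q x + t * p x) - \<Phi> q) / t" if "0 < t" for t
  proof -
    have "pairing M (\<lambda>x. q x + t * p x) qs \<le> \<Phi> (\<lambda>x. q x + t * p x)"
      using qs prediction_cone_add[OF P q prediction_cone_scale[OF p that]]
      unfolding integrable_subgradient_def by simp
    \<comment> \<open>Equality of the subgradient with \<open>\<Phi>\<close> at \<open>q\<close>
      puts \<open>\<Phi> q\<close> in place of \<open>pairing M q qs\<close>, so this term can be
      moved into the difference quotient.\<close>
    moreover have "pairing M (\<lambda>x. q x + t * p x) qs = \<Phi> q + t * pairing M p qs"
      using qs pairing_add_scaled[OF P _ q p] unfolding integrable_subgradient_def by simp
    ultimately show ?thesis
      using that by (simp add: le_divide_eq mult.commute)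
  qed
  then show "\<forall>\<^sub>F t in at_right 0.
      ereal (pairing M p qs) \<le> ereal ((\<Phi> (\<lambda>x. q x + t * p x) - \<Phi> q) / t)"
    by (auto simp: eventually_at_filter)
qed simp

theorem theorem3p1:
  fixes M :: "'a measure" and P :: "('a \<Rightarrow> real) set"
    and \<Phi> :: "('a \<Rightarrow> real) \<Rightarrow> real" and q :: "'a \<Rightarrow> real"
  assumes "prediction_set M P"
    and "sublinear_on_cone P \<Phi>"
    and "q \<in> prediction_cone P"
  shows "(\<exists>qs. integrable_subgradient M P \<Phi> q qs) \<longleftrightarrow>
    (\<exists>qs\<in>integrable_class M P.
       (\<forall>p\<in>prediction_cone P.
          ereal (pairing M p qs) \<le> right_directional_derivative \<Phi> p q) \<and>
       ereal (pairing M q qs) = right_directional_derivative \<Phi> q q)"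
proof
  assume "\<exists>qs. integrable_subgradient M P \<Phi> q qs"
  then obtain qs where qs: "integrable_subgradient M P \<Phi> q qs" ..
  then have "qs \<in> integrable_class M P" "pairing M q qs = \<Phi> q"
    unfolding integrable_subgradient_def by auto
  with qs show "\<exists>qs\<in>integrable_class M P.
       (\<forall>p\<in>prediction_cone P.
          ereal (pairing M p qs) \<le> right_directional_derivative \<Phi> p q) \<and>
       ereal (pairing M q qs) = right_directional_derivative \<Phi> q q"
    using integrable_subgradient_le_right_directional_derivative[OF assms]
      right_directional_derivative_self[OF assms(2,3)] by auto
next
  assume "\<exists>qs\<in>integrable_class M P.
       (\<forall>p\<in>prediction_cone P.
          ereal (pairing M p qs) \<le> right_directional_derivative \<Phi> p q) \<and>
       ereal (pairing M q qs) = right_directional_derivative \<Phi> q q"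
  then obtain qs where qs: "qs \<in> integrable_class M P"
    "\<And>p. p \<in> prediction_cone P \<Longrightarrow>
      ereal (pairing M p qs) \<le> right_directional_derivative \<Phi> p q"
    "ereal (pairing M q qs) = right_directional_derivative \<Phi> q q"
    by blast
  \<comment> \<open>The derivative serves only as a middle term in \<open>ereal\<close>; both ends
    are real, so the inequality descends to the reals.\<close>
  have "pairing M p qs \<le> \<Phi> p" if "p \<in> prediction_cone P" for p
    using order_trans[OF qs(2)[OF that] right_directional_derivative_le[OF assms that]] by simp
  moreover have "pairing M q qs = \<Phi> q"
    using qs(3) right_directional_derivative_self[OF assms(2,3)] by simp
  ultimately show "\<exists>qs. integrable_subgradient M P \<Phi> q qs"
    using qs(1) unfolding integrable_subgradient_def by blast
qed

end
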